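(* Let the calibration window, data $\bm Y_{\mathcal I}$, NLARX structure $\bm\alpha$, feature map $\bm\phi_{\bm\alpha}$, admissible parameter set $\mathbb K_{\bm\alpha}$, simulator $\mathscr S_{\mathcal I,\bm\alpha}$, reconstruction operator $\mathscr R_{\mathcal I,\bm\alpha}$ and functionals $\mathcal J_{\mathcal I,0}(\cdot\,;\bm Y)$, $\mathcal J_{\mathcal I,\lambda_{\mathrm{reg}}}(\cdot\,;\bm Y)$ be as defined in the context. (i) (Existence) Assume that $\mathbb K_{\bm\alpha}$ is nonempty and closed, that $\bm\phi_{\bm\alpha}$ is continuous, and that for every $\bm B\in\mathbb K_{\bm\alpha}$ the recursive simulation remains finite at all local indices $k=1,\ldots,K_{\mathcal I}$. Then for every $\lambda_{\mathrm{reg}}>0$ and every admissible finite calibration window the problem of minimizing $\mathcal J_{\mathcal I,\lambda_{\mathrm{reg}}}(\bm B;\bm Y_{\mathcal I})$ over $\bm B\in\mathbb K_{\bm\alpha}$ has at least one solution. (ii) (Uniqueness and inverse stability) Assume in addition that $\mathbb K_{\bm\alpha}$ is nonempty, compact and convex; that the selected modes, the prescribed initial coefficient history and the reference vector are kept fixed; that $\mathscr R_{\mathcal I,\bm\alpha}$ is twice continuously differentiable with respect to $\bm B$ on a neighborhood of $\mathbb K_{\bm\alpha}$; and that there exist a bounded neighborhood $\mathcal V\subset\mathbb F^{m\times N_{\mathcal I}}$ of $\bm Y_{\mathcal I}$ and finite constants $\rho_{\mathcal I}\ge0$, $L_{\mathcal I}\ge0$ such that, for every $\bm B\in\mathbb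 K_{\bm\alpha}$, every parameter increment $\bm\Delta\in\mathbb F^{r^\star\times p_{\bm\alpha}}$ and all $\bm Y,\bm Y_1,\bm Y_2\in\mathcal V$, $$D_{\bm B}^2\mathcal J_{\mathcal I,0}(\bm B;\bm Y)[\bm\Delta,\bm\Delta]\ge-2\rho_{\mathcal I}\|\bm\Delta\|_F^2,$$ $$\bigl\|\nabla_{\bm B}\mathcal J_{\mathcal I,0}(\bm B;\bm Y_1)-\nabla_{\bm B}\mathcal J_{\mathcal I,0}(\bm B;\bm Y_2)\bigr\|_F\le2L_{\mathcal I}\|\bm Y_1-\bm Y_2\|_F;$$ and that $\lambda_{\mathrm{reg}}>\rho_{\mathcal I}$ (with $\lambda_{\mathrm{reg}}>0$). Then for every $\bm Y\in\mathcal V$ the functional $\mathcal J_{\mathcal I,\lambda_{\mathrm{reg}}}(\cdot\,;\bm Y)$ admits exactly one minimizer $\bm B^\star(\bm Y)$ on $\mathbb K_{\bm\alpha}$, and for any $\bm Y_{\mathcal I}^{(1)},\bm Y_{\mathcal I}^{(2)}\in\mathcal V$, $$\bigl\|\bm B^\star(\bm Y_{\mathcal I}^{(1)})-\bm B^\star(\bm Y_{\mathcal I}^{(2)})\bigr\|_F\le\frac{L_{\mathcal I}}{\lambda_{\mathrm{reg}}-\rho_{\mathcal I}}\bigl\|\bm Y_{\mathcal I}^{(1)}-\bm Y_{\mathcal I}^{(2)}\bigr\|_F .$$ Consequently, the regularized reconstruction model (determined by $\bm B^\star(\bm Y)$) is uniquely defined and Lipschitz stable with respect to noisy finite-window calibration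 data.
   Context: $\mathbb F=\mathbb R$ or $\mathbb C$. If $\mathbb F=\mathbb C$, matrix spaces are regarded as real Hilbert spaces with inner product $\operatorname{Re}\operatorname{trace}(\bm A^{\mathrm H}\bm B)$, and derivatives and gradients with respect to $\bm B$ are taken in this sense. Window and data. A record $\bm Y=[\bm y_1,\ldots,\bm y_N]\in\mathbb F^{m\times N}$ of $m$ channels at times $t_1<\cdots<t_N$ (uniform spacing) is given, with a fixed reference vector $\bar{\bm y}\in\mathbb F^m$. A finite calibration window is a set of consecutive times $\mathcal T_H=\{t_k:k=n_{\mathrm s},\ldots,n_{\mathrm s}+H\}$, where $n_{\mathrm s}=N_Q+1$ for an integer $1\le N_Q<N$ and $H\ge0$ is an integer with $n_{\mathrm s}+H\le N$. Put $N_{\mathcal I}=H+1$, $N_{H,\mathcal I}=mN_{\mathcal I}$, and, for a fixed delay depth $q\ge1$, $K_{\mathcal I}=N_{H,\mathcal I}-q+1$; the window is admissible if $K_{\mathcal I}\ge2$. $\bm Y_{\mathcal I}=[\bm y_{n_{\mathrm s}},\ldots,\bm y_{n_{\mathrm s}+H}]\in\mathbb F^{m\times N_{\mathcal I}}$, and $\bm 1_{N_{\mathcal I}}$ is the all-ones column vector. Let $\bm x_{H,\mathcal I}=\operatorname{vec}(\bm Y_{\mathcal I}-\bar{\bm y}\bm 1_{N_{\mathcal I}}^{\mathsf T})\in\mathbb F^{N_{H,\mathcal I}}$ (columnwise vectorization) and let $\bm H_{\mathcal I}\in\mathbb F^{q\times K_{\mathcal I}}$ be its Hankel matrix, with $(i,j)$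 entry equal to entry $i+j-1$ of $\bm x_{H,\mathcal I}$. $\bm\Phi_{r^\star}\in\mathbb F^{q\times r^\star}$ is the fixed matrix of selected modes, with $\bm\Phi_{r^\star}^{\mathrm H}\bm\Phi_{r^\star}=\bm I_{r^\star}$, and $\bm C_{\mathcal I}=\bm\Phi_{r^\star}^{\mathrm H}\bm H_{\mathcal I}=[\bm c_{\mathcal I,1},\ldots,\bm c_{\mathcal I,K_{\mathcal I}}]\in\mathbb F^{r^\star\times K_{\mathcal I}}$. NLARX model and simulator. $\bm\alpha=(n_a,n_b,n_k)$ is a triple of integers $\ge1$, $\ell_{\bm\alpha}=\max\{n_a,n_k+n_b-1\}<K_{\mathcal I}$, and $\bm\phi_{\bm\alpha}:\mathbb F^{d_{\bm\alpha}}\to\mathbb F^{p_{\bm\alpha}}$ is a fixed feature map with $d_{\bm\alpha}=r^\star(n_a+n_b)$. The parameter set $\mathbb K_{\bm\alpha}\subset\mathbb F^{r^\star\times p_{\bm\alpha}}$. For $\bm B\in\mathbb F^{r^\star\times p_{\bm\alpha}}$, the simulated matrix $\mathscr S_{\mathcal I,\bm\alpha}(\bm B)=[\widetilde{\bm c}_{\mathcal I,1},\ldots,\widetilde{\bm c}_{\mathcal I,K_{\mathcal I}}]\in\mathbb F^{r^\star\times K_{\mathcal I}}$ is defined by fixing the prescribed initial history $\widetilde{\bm c}_{\mathcal I,k}=\bm c_{\mathcal I,k}$ for $k=1,\ldots,\ell_{\bm\alpha}$ and recursively, for $k=\ell_{\bm\alpha},\ldots,K_{\mathcal I}-1$, $$\widetilde{\bm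 c}_{\mathcal I,k+1}=\bm B\,\bm\phi_{\bm\alpha}\bigl(\widetilde{\bm c}_{\mathcal I,k},\ldots,\widetilde{\bm c}_{\mathcal I,k-n_a+1};\ \widetilde{\bm c}_{\mathcal I,k-n_k+1},\ldots,\widetilde{\bm c}_{\mathcal I,k-n_k-n_b+2}\bigr).$$ Reconstruction. $\mathscr A_{\mathcal I}:\mathbb F^{q\times K_{\mathcal I}}\to\mathbb F^{m\times N_{\mathcal I}}$ is uniform anti-diagonal averaging followed by reshaping: from $\bm Z\in\mathbb F^{q\times K_{\mathcal I}}$ form the vector with entries $\frac1{\nu_\ell}\sum_{i+k-1=\ell}Z_{i,k}$, $\ell=1,\ldots,N_{H,\mathcal I}$, where $\nu_\ell$ is the number of index pairs $(i,k)$ with $1\le i\le q$, $1\le k\le K_{\mathcal I}$, $i+k-1=\ell$, and reshape it columnwise into an $m\times N_{\mathcal I}$ matrix. The reconstruction operator is $$\mathscr R_{\mathcal I,\bm\alpha}(\bm B)=\bar{\bm y}\bm 1_{N_{\mathcal I}}^{\mathsf T}+\mathscr A_{\mathcal I}\bigl(\bm\Phi_{r^\star}\mathscr S_{\mathcal I,\bm\alpha}(\bm B)\bigr)\in\mathbb F^{m\times N_{\mathcal I}} .$$ Functionals. With a fixed constant $\epsilon_{\mathrm{mach}}>0$ and for $\bm Y\in\mathbb F^{m\times N_{\mathcal I}}$, $$\mathcal J_{\mathcal I,0}(\bm B;\bm Y)=\frac{\|\bm Y-\mathscr R_{\mathcal I,\bm\alpha}(\bm B)\|_F^2}{\|\bm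 Y-\bar{\bm y}\bm 1_{N_{\mathcal I}}^{\mathsf T}\|_F^2+\epsilon_{\mathrm{mach}}},\qquad \mathcal J_{\mathcal I,\lambda_{\mathrm{reg}}}(\bm B;\bm Y)=\mathcal J_{\mathcal I,0}(\bm B;\bm Y)+\lambda_{\mathrm{reg}}\|\bm B\|_F^2 .$$ When $\bm Y$ varies in part (ii), $\mathscr R_{\mathcal I,\bm\alpha}$ (hence the initial history obtained from $\bm Y_{\mathcal I}$, $\bm\Phi_{r^\star}$ and $\bar{\bm y}$) does not change. *)

theory Defs
  imports "HOL-Analysis.Analysis"
begin

text \<open>
  Scalars have the sort \<open>{real_normed_field, euclidean_space}\<close>, the finite-dimensional commutative
  real division algebras with a multiplicative Euclidean norm. By the theorems of Frobenius and
  Gelfand-Mazur these are exactly \<open>\<real>\<close> and \<open>\<complex>\<close>, and both library types are instances. A matrix in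
  \<open>\<bbbF>\<^bsup>a\<times>b\<^esup>\<close> is a term of type \<open>'f ^ 'b ^ 'a\<close>; the library's norm on it is the Frobenius
  norm and its inner product is the real one, \<open>Re (trace (A\<^sup>H B))\<close> (see \<open>inner_matrix_real\<close> and
  \<open>inner_matrix_complex\<close>).

  The conjugate is \<open>|x|\<^sup>2 / x\<close>, which is 0 at \<open>x = 0\<close> since division by 0 yields 0.
\<close>

definition fconj :: "'f::real_normed_field \<Rightarrow> 'f"
  where "fconj x = of_real ((norm x)\<^sup>2) / x"

lemma fconj_real: "fconj (x::real) = x"
  by (simp add: fconj_def power2_eq_square)

lemma fconj_complex: "fconj (z::complex) = cnj z"
proof (cases "z = 0")
  case False
  have "of_real ((norm z)\<^sup>2) = cnj z * z"
    by (simp only: complex_norm_square mult.commute)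
  with False show ?thesis by (simp add: fconj_def)
qed (simp add: fconj_def)

definition hermitian :: "'f::real_normed_field ^ 'b ^ 'a \<Rightarrow> 'f ^ 'a ^ 'b"
  where "hermitian A = (\<chi> i j. fconj (A $ j $ i))"

lemma inner_matrix_real:
  fixes A B :: "real ^ 'b ^ 'a"
  shows "A \<bullet> B = trace (hermitian A ** B)"
  unfolding inner_vec_def trace_def hermitian_def matrix_matrix_mult_def
  by (simp add: fconj_real) (rule sum.swap)

lemma inner_matrix_complex:
  fixes A B :: "complex ^ 'b ^ 'a"
  shows "A \<bullet> B = Re (trace (hermitian A ** B))"
  unfolding inner_vec_def trace_def hermitian_def matrix_matrix_mult_def
  by (simp add: fconj_complex inner_complex_def) (rule sum.swap)

text \<open>
  Ordered finite index types stand for \<open>{1..n}\<close> with \<open>n\<close> the cardinality of the type: \<open>pos i\<close> is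
  the 1-based position of \<open>i\<close>, and \<open>idx k\<close> the index at position \<open>k\<close>, for \<open>1 \<le> k \<le> n\<close>.
\<close>

definition pos :: "'a::{finite,linorder} \<Rightarrow> nat"
  where "pos i = card {..i}"

definition idx :: "nat \<Rightarrow> 'a::{finite,linorder}"
  where "idx k = inv pos k"

lemma pos_less: "i < j \<Longrightarrow> pos i < pos (j::'a::{finite,linorder})"
  unfolding pos_def by (rule psubset_card_mono) auto

lemma bij_betw_pos: "bij_betw (pos :: 'a::{finite,linorder} \<Rightarrow> nat) UNIV {1..CARD('a)}"
proof -
  have inj: "inj (pos :: 'a \<Rightarrow> nat)"
    by (rule injI) (metis neqE less_irrefl pos_less)
  have "pos i \<in> {1..CARD('a)}" for i :: 'a
  proof -
    have "card {..i} > 0" by (subst card_gt_0_iff) auto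
    moreover have "card {..i} \<le> CARD('a)" by (rule card_mono) auto
    ultimately show ?thesis by (simp add: pos_def)
  qed
  then have "range (pos :: 'a \<Rightarrow> nat) \<subseteq> {1..CARD('a)}" by auto
  moreover have "card (range (pos :: 'a \<Rightarrow> nat)) = card {1..CARD('a)}"
    by (simp add: card_image inj)
  ultimately have "range (pos :: 'a \<Rightarrow> nat) = {1..CARD('a)}"
    using card_subset_eq[OF finite_atLeastAtMost] by blast
  with inj show ?thesis by (simp add: bij_betw_def)
qed

lemma idx_pos [simp]: "idx (pos i) = (i :: 'a::{finite,linorder})"
  using bij_betw_pos[where 'a = 'a] by (simp add: idx_def bij_betw_def)

lemma pos_idx: "k \<in> {1..CARD('a)} \<Longrightarrow> pos (idx k :: 'a::{finite,linorder}) = k"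
  using bij_betw_pos[where 'a = 'a] by (simp add: idx_def bij_betw_def f_inv_into_f)


definition window_data ::
    "'f ^ 't::{finite,linorder} ^ 'm \<Rightarrow> nat \<Rightarrow> 'f ^ 'n::{finite,linorder} ^ 'm"
  where "window_data Y ns = (\<chi> i j. Y $ i $ idx (ns + pos j - 1))"

definition ref_matrix :: "'f ^ 'm \<Rightarrow> 'f ^ 'n ^ 'm"
  where "ref_matrix ybar = (\<chi> i j. ybar $ i)"

text \<open>Entry \<open>l\<close> of \<open>vec X\<close>, for \<open>1 \<le> l \<le> m n\<close>.\<close>

definition vec_entry :: "'f ^ 'n::{finite,linorder} ^ 'm::{finite,linorder} \<Rightarrow> nat \<Rightarrow> 'f"
  where "vec_entry X l = X $ idx ((l - 1) mod CARD('m) + 1) $ idx ((l - 1) div CARD('m) + 1)"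

definition reshape :: "(nat \<Rightarrow> 'f) \<Rightarrow> 'f ^ 'n::{finite,linorder} ^ 'm::{finite,linorder}"
  where "reshape v = (\<chi> i j. v ((pos j - 1) * CARD('m) + pos i))"

lemma reshape_vec_entry:
  fixes X :: "'f ^ 'a::{finite,linorder} ^ 'b::{finite,linorder}"
  shows "reshape (vec_entry X) = X"
proof -
  have "vec_entry X ((pos j - 1) * CARD('b) + pos i) = X $ i $ j" for i :: 'b and j :: 'a
  proof -
    have p: "pos i \<in> {1..CARD('b)}" "pos j \<in> {1..CARD('a)}"
      using bij_betw_pos[where 'a = 'b] bij_betw_pos[where 'a = 'a] by (auto simp: bij_betw_def)
    then obtain a b where ab: "pos i = Suc a" "pos j = Suc b" "a < CARD('b)"
      by (metis Suc_le_D Suc_le_lessD One_nat_def atLeastAtMost_iff)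
    have "((pos j - 1) * CARD('b) + pos i - 1) mod CARD('b) + 1 = pos i"
      and "((pos j - 1) * CARD('b) + pos i - 1) div CARD('b) + 1 = pos j"
      using ab by simp_all
    then show ?thesis
      unfolding vec_entry_def by (simp only: idx_pos)
  qed
  then show ?thesis by (simp add: reshape_def vec_eq_iff)
qed

definition hankel ::
    "'f ^ 'n::{finite,linorder} ^ 'm::{finite,linorder} \<Rightarrow>
     'f ^ 'k::{finite,linorder} ^ 'q::{finite,linorder}"
  where "hankel X = (\<chi> i j. vec_entry X (pos i + pos j - 1))"

definition coeff_matrix ::
    "'f::real_normed_field ^ 'r ^ 'q::{finite,linorder} \<Rightarrow> 'f ^ 'm::{finite,linorder} \<Rightarrow>
     'f ^ 'n::{finite,linorder} ^ 'm::{finite,linorder} \<Rightarrow> 'f ^ 'k::{finite,linorder} ^ 'r"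
  where "coeff_matrix \<Phi> ybar Y = hermitian \<Phi> ** hankel (Y - ref_matrix ybar)"


text \<open>
  The feature map takes the \<open>n\<^sub>a + n\<^sub>b\<close> delayed vectors stacked into one vector of length
  \<open>r (n\<^sub>a + n\<^sub>b)\<close>. Block \<open>s < n\<^sub>a\<close> (counted from 0) is \<open>c\<^bsub>k-s\<^esub>\<close>; block \<open>n\<^sub>a + s\<close> is
  \<open>c\<^bsub>k-n\<^sub>k+1-s\<^esub>\<close>. For \<open>n\<^sub>k \<ge> 1\<close> and \<open>k\<close> at least the maximal lag, none of the subtractions
  truncates.
\<close>

definition max_lag :: "nat \<Rightarrow> nat \<Rightarrow> nat \<Rightarrow> nat"
  where "max_lag na nb nk = max na (nk + nb - 1)"

definition regressor ::
    "nat \<Rightarrow> nat \<Rightarrow> (nat \<Rightarrow> 'f ^ 'r::{finite,linorder}) \<Rightarrow> nat \<Rightarrow> 'f ^ 'd::{finite,linorder}"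
  where "regressor na nk c k = (\<chi> j.
    let s = (pos j - 1) div CARD('r); i = idx ((pos j - 1) mod CARD('r) + 1)
    in (if s < na then c (k - s) else c (k - (nk - 1) - (s - na))) $ i)"

lemma regressor_cong [fundef_cong]:
  assumes "na = na'" "nk = nk'" "k = k'" "\<And>i. i \<le> k' \<Longrightarrow> c i = c' i"
  shows "regressor na nk c k = regressor na' nk' c' k'"
  using assms by (auto simp: regressor_def Let_def vec_eq_iff)

function sim_seq ::
    "nat \<Rightarrow> nat \<Rightarrow> nat \<Rightarrow> ('f ^ 'd::{finite,linorder} \<Rightarrow> 'f ^ 'p) \<Rightarrow>
     'f::semiring_1 ^ 'k::{finite,linorder} ^ 'r::{finite,linorder} \<Rightarrow>
     'f ^ 'p ^ 'r::{finite,linorder} \<Rightarrow> nat \<Rightarrow> 'f ^ 'r::{finite,linorder}"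
  where "sim_seq na nb nk \<phi> C B k =
    (if k \<le> max_lag na nb nk then column (idx k) C
     else B *v \<phi> (regressor na nk (sim_seq na nb nk \<phi> C B) (k - 1)))"
  by pat_completeness auto
termination
  by (relation "Wellfounded.measure (\<lambda>(na, nb, nk, \<phi>, C, B, k). k)") auto

declare sim_seq.simps [simp del]

definition simulator ::
    "nat \<Rightarrow> nat \<Rightarrow> nat \<Rightarrow> ('f ^ 'd::{finite,linorder} \<Rightarrow> 'f ^ 'p) \<Rightarrow>
     'f::semiring_1 ^ 'k::{finite,linorder} ^ 'r::{finite,linorder} \<Rightarrow>
     'f ^ 'p ^ 'r::{finite,linorder} \<Rightarrow> 'f ^ 'k::{finite,linorder} ^ 'r::{finite,linorder}"
  where "simulator na nb nk \<phi> C B = (\<chi> i k. sim_seq na nb nk \<phi> C B (pos k) $ i)"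


definition antidiag_avg ::
    "'f::field ^ 'k::{finite,linorder} ^ 'q::{finite,linorder} \<Rightarrow> nat \<Rightarrow> 'f"
  where "antidiag_avg Z l =
    (let D = {(i, k). pos i + pos k - 1 = l}
     in (\<Sum>(i, k)\<in>D. Z $ i $ k) / of_nat (card D))"

definition reconstruct ::
    "nat \<Rightarrow> nat \<Rightarrow> nat \<Rightarrow> ('f ^ 'd::{finite,linorder} \<Rightarrow> 'f ^ 'p) \<Rightarrow>
     'f::field ^ 'r::{finite,linorder} ^ 'q::{finite,linorder} \<Rightarrow> 'f ^ 'm::{finite,linorder} \<Rightarrow>
     'f ^ 'k::{finite,linorder} ^ 'r::{finite,linorder} \<Rightarrow>
     'f ^ 'p ^ 'r::{finite,linorder} \<Rightarrow> 'f ^ 'n::{finite,linorder} ^ 'm::{finite,linorder}"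
  where "reconstruct na nb nk \<phi> \<Phi> ybar C B =
    ref_matrix ybar + reshape (antidiag_avg (\<Phi> ** simulator na nb nk \<phi> C B))"


text \<open>
  In the functionals, \<open>R\<close> is the reconstruction operator, a parameter that does not depend on \<open>Y\<close>.
\<close>

definition J0 ::
    "real \<Rightarrow> 'f ^ 'm \<Rightarrow> ('b \<Rightarrow> 'f::real_normed_vector ^ 'n ^ 'm) \<Rightarrow> 'f ^ 'n ^ 'm \<Rightarrow> 'b \<Rightarrow> real"
  where "J0 eps ybar R Y B =
    (norm (Y - R B))\<^sup>2 / ((norm (Y - ref_matrix ybar))\<^sup>2 + eps)"

definition Jreg ::
    "real \<Rightarrow> 'f ^ 'm \<Rightarrow> ('b::real_normed_vector \<Rightarrow> 'f::real_normed_vector ^ 'n ^ 'm) \<Rightarrow>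
     real \<Rightarrow> 'f ^ 'n ^ 'm \<Rightarrow> 'b \<Rightarrow> real"
  where "Jreg eps ybar R lam Y B = J0 eps ybar R Y B + lam * (norm B)\<^sup>2"


definition C2_on :: "'a::real_normed_vector set \<Rightarrow> ('a \<Rightarrow> 'b::real_normed_vector) \<Rightarrow> bool"
  where "C2_on U f \<longleftrightarrow>
    (\<exists>(f' :: 'a \<Rightarrow> 'a \<Rightarrow>\<^sub>L 'b) (f'' :: 'a \<Rightarrow> 'a \<Rightarrow>\<^sub>L ('a \<Rightarrow>\<^sub>L 'b)).
      (\<forall>x\<in>U. (f has_derivative blinfun_apply (f' x)) (at x)) \<and>
      (\<forall>x\<in>U. (f' has_derivative blinfun_apply (f'' x)) (at x)) \<and>
      continuous_on U f'')"

definition gradient :: "('a::real_inner \<Rightarrow> real) \<Rightarrow> 'a \<Rightarrow> 'a"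
  where "gradient f x = (THE D. GDERIV f x :> D)"

text \<open>\<open>D\<^sup>2 f x [u, v]\<close>: the derivative in direction \<open>v\<close>, at \<open>x\<close>, of \<open>z \<mapsto> Df z [u]\<close>.\<close>

definition second_derivative ::
    "('a::real_normed_vector \<Rightarrow> real) \<Rightarrow> 'a \<Rightarrow> 'a \<Rightarrow> 'a \<Rightarrow> real"
  where "second_derivative f x u v =
    frechet_derivative (\<lambda>z. frechet_derivative f (at z) u) (at x) v"

end

theory Submission
  imports Defs
begin

text \<open>
  Existence: the simulation is a finite recursion built from \<open>\<phi>\<close> and matrix products, so \<open>R\<close> is
  continuous, and \<open>\<lambda> \<parallel>B\<parallel>\<^sup>2\<close> makes the functional coercive. Uniqueness and stability: the bound on the
  second derivative makes the gradient of the regularized functional strongly monotone on \<open>\<K>\<close> with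
  constant \<open>2 (\<lambda> - \<rho>)\<close>. Adding the variational inequalities of two minimizers, for data \<open>Y\<^sub>1\<close> and
  \<open>Y\<^sub>2\<close>, and testing each with the other, gives
  \<open>2 (\<lambda> - \<rho>) \<parallel>B\<^sub>1 - B\<^sub>2\<parallel>\<^sup>2 \<le> 2 L \<parallel>Y\<^sub>1 - Y\<^sub>2\<parallel> \<parallel>B\<^sub>1 - B\<^sub>2\<parallel>\<close>; the case \<open>Y\<^sub>1 = Y\<^sub>2\<close> is uniqueness.
\<close>

section \<open>Continuity of the simulation and the reconstruction in the parameters\<close>

lemma continuous_on_regressor:
  fixes c :: "'a::topological_space \<Rightarrow> nat \<Rightarrow> 'f::real_normed_vector ^ 'r::{finite,linorder}"
  assumes "\<And>i. i \<le> k \<Longrightarrow> continuous_on S (\<lambda>x. c x i)"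
  shows "continuous_on S (\<lambda>x. regressor na nk (c x) k :: 'f ^ 'd::{finite,linorder})"
proof -
  \<comment> \<open>Natural-number subtraction only lowers the index, so every vector read has index
    at most \<open>k\<close>; the strong induction in \<open>continuous_on_sim_seq\<close> relies on
    this.\<close>
  have "continuous_on S (\<lambda>x. (if s < na then c x (k - s) else c x (k - (nk - 1) - (s - na))) $ i)"
    for s i
    by (cases "s < na") (auto intro!: continuous_intros assms)
  then show ?thesis
    unfolding regressor_def Let_def by (intro continuous_on_vec_lambda)
qed

lemma continuous_on_matrix_mult:
  fixes f :: "'a::topological_space \<Rightarrow> 'f::real_normed_field ^ 'n ^ 'm"
    and g :: "'a \<Rightarrow> 'f ^ 'p ^ 'n"
  assumes "continuous_on S f" "continuous_on S g"
  shows "continuous_on S (\<lambda>x. f x ** g x)"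
  unfolding matrix_matrix_mult_def by (intro continuous_intros assms)

lemma continuous_on_matrix_vector_mult:
  fixes f :: "'a::topological_space \<Rightarrow> 'f::real_normed_field ^ 'n ^ 'm"
    and g :: "'a \<Rightarrow> 'f ^ 'n"
  assumes "continuous_on S f" "continuous_on S g"
  shows "continuous_on S (\<lambda>x. f x *v g x)"
  unfolding matrix_vector_mult_def by (intro continuous_intros assms)

lemma continuous_on_sim_seq:
  fixes \<phi> :: "'f::real_normed_field ^ 'd::{finite,linorder} \<Rightarrow> 'f ^ 'p"
    and C :: "'f ^ 'k::{finite,linorder} ^ 'r::{finite,linorder}"
  assumes "continuous_on UNIV \<phi>"
  shows "continuous_on S (\<lambda>B. sim_seq na nb nk \<phi> C B k)"
proof (induction k rule: less_induct)
  case (less k)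
  show ?case
  proof (cases "k \<le> max_lag na nb nk")
    case True
    then show ?thesis by (subst sim_seq.simps) simp
  next
    case False
    then have "continuous_on S (\<lambda>B. regressor na nk (sim_seq na nb nk \<phi> C B) (k - 1) :: 'f ^ 'd::{finite,linorder})"
      by (intro continuous_on_regressor less.IH) simp
    then have "continuous_on S (\<lambda>B. B *v \<phi> (regressor na nk (sim_seq na nb nk \<phi> C B) (k - 1)))"
      by (intro continuous_on_matrix_vector_mult continuous_on_id
          continuous_on_compose2[OF assms]) auto
    with False show ?thesis by (subst sim_seq.simps) simp
  qed
qed

lemma continuous_on_reconstruct:
  fixes \<phi> :: "'f::real_normed_field ^ 'd::{finite,linorder} \<Rightarrow> 'f ^ 'p"
  assumes "continuous_on UNIV \<phi>"
  shows "continuous_on S (reconstruct na nb nk \<phi> \<Phi> ybar C)"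
proof -
  have *: "continuous_on S (\<lambda>B. \<Phi> ** simulator na nb nk \<phi> C B)"
    unfolding simulator_def
    by (intro continuous_on_matrix_mult continuous_intros continuous_on_sim_seq assms)
  \<comment> \<open>Division by the number of index pairs becomes multiplication by a constant
    \<open>inverse\<close>, which leaves finite sums of matrix entries times constants.\<close>
  show ?thesis
    unfolding reconstruct_def reshape_def antidiag_avg_def Let_def divide_inverse case_prod_beta
    by (intro continuous_intros *)
qed

section \<open>Minimizers of coercive functions on closed sets\<close>

text \<open>The quadratic lower bound puts every point with \<open>f x \<le> f a\<close> into one
  ball about 0; Weierstrass on the compact part of \<open>K\<close> in that ball gives the
  minimizer.\<close>

lemma arg_min_on_closed_coercive:
  fixes f :: "'a::euclidean_space \<Rightarrow> real"
  assumes "closed K" "K \<noteq> {}" "continuous_on K f" "lam > 0" "\<And>x. lam * (norm x)\<^sup>2 \<le> f x"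
  shows "\<exists>x. is_arg_min f (\<lambda>x. x \<in> K) x"
proof -
  obtain a where a: "a \<in> K" using assms by auto
  define r where "r = sqrt (f a / lam)"
  have fa: "f a \<ge> 0" using assms(4) order_trans[OF _ assms(5)[of a]] by simp
  have small: "norm x \<le> r" if "f x \<le> f a" for x
  proof -
    have "lam * (norm x)\<^sup>2 \<le> f a" using assms(5)[of x] that by linarith
    then have "(norm x)\<^sup>2 \<le> f a / lam" using assms(4) by (simp add: field_simps)
    then show ?thesis unfolding r_def by (rule real_le_rsqrt)
  qed
  have "compact (K \<inter> cball 0 r)" using assms(1) by (simp add: closed_Int_compact)
  moreover have "a \<in> K \<inter> cball 0 r" using a small[of a] by simp
  moreover have "continuous_on (K \<inter> cball 0 r) f"
    using assms(3) by (rule continuous_on_subset) auto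
  ultimately obtain b where b: "b \<in> K \<inter> cball 0 r" "\<And>y. y \<in> K \<inter> cball 0 r \<Longrightarrow> f b \<le> f y"
    using continuous_attains_inf[of "K \<inter> cball 0 r" f] by (metis empty_iff)
  \<comment> \<open>Either \<open>f y \<le> f a\<close>, and then \<open>y\<close> lies in the ball,
    or \<open>f b \<le> f a < f y\<close>.\<close>
  have "f b \<le> f y" if "y \<in> K" for y
    using b small[of y] \<open>a \<in> K \<inter> cball 0 r\<close> that by (force simp: not_le)
  then show ?thesis using b by (auto simp: is_arg_min_linorder)
qed

section \<open>Gradients, monotonicity and first-order conditions\<close>

text \<open>\<open>gradient\<close> is a definite description, so a representing vector must be
  shown to exist and to be unique. Existence is the Riesz representation written out in
  \<open>Basis\<close>; uniqueness comes from that of the derivative.\<close>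

lemma gradient_inner:
  fixes f :: "'a::euclidean_space \<Rightarrow> real"
  assumes "f differentiable (at x)"
  shows "gradient f x \<bullet> h = frechet_derivative f (at x) h"
proof -
  let ?D = "frechet_derivative f (at x)"
  let ?g = "\<Sum>b\<in>Basis. ?D b *\<^sub>R b"
  have D: "(f has_derivative ?D) (at x)"
    using assms by (simp add: frechet_derivative_works)
  then have lin: "linear ?D" by (rule has_derivative_linear)
  have rep: "h \<bullet> ?g = ?D h" for h
  proof -
    have "?D h = ?D (\<Sum>b\<in>Basis. (h \<bullet> b) *\<^sub>R b)" by (simp add: euclidean_representation)
    also have "\<dots> = (\<Sum>b\<in>Basis. (h \<bullet> b) * ?D b)"
      by (simp add: linear_sum[OF lin] linear_cmul[OF lin])
    finally show ?thesis by (simp add: inner_sum_right mult.commute)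
  qed
  then have "GDERIV f x :> ?g"
    using D by (simp add: gderiv_def)
  moreover have "E = ?g" if "GDERIV f x :> E" for E
  proof -
    have "(\<lambda>h. h \<bullet> E) = ?D"
      using that D unfolding gderiv_def by (rule has_derivative_unique)
    then have "h \<bullet> E = h \<bullet> ?g" for h
      using rep by metis
    then show ?thesis
      using vector_eq_ldot by blast
  qed
  ultimately have "GDERIV f x :> gradient f x"
    unfolding gradient_def by (rule theI)
  then have "(f has_derivative (\<lambda>h. h \<bullet> gradient f x)) (at x)"
    by (simp add: gderiv_def)
  then have "(\<lambda>h. h \<bullet> gradient f x) = ?D"
    by (rule frechet_derivative_at)
  then show ?thesis by (metis inner_commute)
qed

lemma has_real_derivative_along_line:
  fixes f :: "'a::real_normed_vector \<Rightarrow> real"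
  assumes "(f has_derivative f') (at (x + s *\<^sub>R u))"
  shows "((\<lambda>s. f (x + s *\<^sub>R u)) has_real_derivative f' u) (at s)"
proof -
  have "((\<lambda>s. x + s *\<^sub>R u) has_vector_derivative u) (at s)"
    by (auto intro!: derivative_eq_intros)
  then have "(f \<circ> (\<lambda>s. x + s *\<^sub>R u) has_vector_derivative f' u) (at s)"
    using has_derivative_at_withinI[OF assms] by (rule vector_derivative_diff_chain_within)
  then show ?thesis
    by (simp add: has_real_derivative_iff_has_vector_derivative o_def)
qed

text \<open>On the segment from \<open>x\<close> to \<open>y\<close>, which convexity keeps in
  \<open>K\<close>, the second derivative in direction \<open>y - x\<close> is an ordinary
  derivative in \<open>s\<close>, and the mean value theorem on \<open>[0, 1]\<close>
  applies.\<close>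

lemma second_derivative_lower_bound_imp_monotone:
  fixes f :: "'a::real_normed_vector \<Rightarrow> real"
  assumes K: "convex K" "x \<in> K" "y \<in> K"
    and diff: "\<And>z. z \<in> K \<Longrightarrow> (\<lambda>w. frechet_derivative f (at w) (y - x)) differentiable (at z)"
    and lower: "\<And>z. z \<in> K \<Longrightarrow> second_derivative f z (y - x) (y - x) \<ge> m"
  shows "frechet_derivative f (at y) (y - x) - frechet_derivative f (at x) (y - x) \<ge> m"
proof -
  define g where "g = (\<lambda>w. frechet_derivative f (at w) (y - x))"
  define p where "p s = x + s *\<^sub>R (y - x)" for s :: real
  have pK: "p s \<in> K" if "0 \<le> s" "s \<le> 1" for s
    using convexD_alt[OF K that] by (simp add: p_def algebra_simps)
  have der: "((\<lambda>s. g (p s)) has_real_derivative second_derivative f (p s) (y - x) (y - x)) (at s)"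
    if "0 \<le> s" "s \<le> 1" for s
  proof -
    have "(g has_derivative frechet_derivative g (at (p s))) (at (p s))"
      using diff[OF pK[OF that]] by (simp add: g_def frechet_derivative_works)
    then show ?thesis
      unfolding p_def second_derivative_def g_def[symmetric]
      by (rule has_real_derivative_along_line)
  qed
  obtain s where s: "0 < s" "s < 1"
    "g (p 1) - g (p 0) = (1 - 0) * second_derivative f (p s) (y - x) (y - x)"
    using MVT2[of 0 1 "\<lambda>s. g (p s)" "\<lambda>s. second_derivative f (p s) (y - x) (y - x)"] der by auto
  moreover have "second_derivative f (p s) (y - x) (y - x) \<ge> m"
    using lower[OF pK] s by simp
  ultimately show ?thesis by (simp add: g_def p_def)
qed

text \<open>With a negative slope towards \<open>y\<close>, a short step in that direction would
  stay in \<open>K\<close> and go below the minimum.\<close>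

lemma is_arg_min_on_convex_variational:
  fixes f :: "'a::real_normed_vector \<Rightarrow> real"
  assumes K: "convex K" "y \<in> K" and min: "is_arg_min f (\<lambda>x. x \<in> K) x"
    and der: "(f has_derivative f') (at x)"
  shows "f' (y - x) \<ge> 0"
proof (rule ccontr)
  assume neg: "\<not> f' (y - x) \<ge> 0"
  define p where "p s = x + s *\<^sub>R (y - x)" for s :: real
  have xK: "x \<in> K" using min by (simp add: is_arg_min_linorder)
  have "((\<lambda>s. f (p s)) has_real_derivative f' (y - x)) (at 0)"
    unfolding p_def using der by (intro has_real_derivative_along_line) simp
  then obtain d where d: "d > 0" "\<And>h. 0 < h \<Longrightarrow> h < d \<Longrightarrow> f (p (0 + h)) < f (p 0)"
    using DERIV_neg_dec_right[of "\<lambda>s. f (p s)" _ 0] neg by (metis not_le)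
  \<comment> \<open>The bound 1 keeps the step on the segment in \<open>K\<close>;
    \<open>d / 2\<close> keeps it where the strict decrease holds.\<close>
  define h where "h = min 1 (d / 2)"
  have h: "0 < h" "h < d" "h \<le> 1" using d(1) by (auto simp: h_def)
  have "p h \<in> K" using convexD_alt[OF K(1) xK K(2), of h] h by (simp add: p_def algebra_simps)
  moreover have "f (p h) < f x" using d(2)[OF h(1,2)] by (simp add: p_def)
  ultimately show False using min by (auto simp: is_arg_min_linorder)
qed

text \<open>\<open>f\<close> and \<open>g\<close> stand for the data terms of two records, and
  \<open>2 * D\<close> bounds the gap between their gradients. At \<open>y\<close> this gap pays for
  replacing the gradient of \<open>g\<close> by that of \<open>f\<close>, so that only the
  monotonicity of the gradient of \<open>f\<close> enters.\<close>

lemma regularized_arg_min_stable: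
  fixes f g :: "'a::euclidean_space \<Rightarrow> real"
  assumes K: "convex K"
    and diff: "\<And>z. z \<in> K \<Longrightarrow> f differentiable (at z)" "\<And>z. z \<in> K \<Longrightarrow> g differentiable (at z)"
    and diff2: "\<And>z u. z \<in> K \<Longrightarrow> (\<lambda>w. frechet_derivative f (at w) u) differentiable (at z)"
    and lower: "\<And>z u. z \<in> K \<Longrightarrow> second_derivative f z u u \<ge> - 2 * \<rho> * (norm u)\<^sup>2"
    and grad: "\<And>z. z \<in> K \<Longrightarrow> norm (gradient f z - gradient g z) \<le> 2 * D"
    and x: "is_arg_min (\<lambda>z. f z + lam * (norm z)\<^sup>2) (\<lambda>z. z \<in> K) x"
    and y: "is_arg_min (\<lambda>z. g z + lam * (norm z)\<^sup>2) (\<lambda>z. z \<in> K) y"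
    and lam: "lam > \<rho>"
  shows "norm (x - y) \<le> D / (lam - \<rho>)"
proof (cases "x = y")
  case True
  have "x \<in> K" using x by (simp add: is_arg_min_linorder)
  \<comment> \<open>No sign of \<open>D\<close> is given; the gradient bound at a single point of
    \<open>K\<close> forces it.\<close>
  then have "0 \<le> 2 * D" using grad norm_ge_zero order_trans by blast
  with True lam show ?thesis by simp
next
  case False
  define u where "u = y - x"
  have xy: "x \<in> K" "y \<in> K" using x y by (simp_all add: is_arg_min_linorder)
  have reg: "((\<lambda>z. h z + lam * (norm z)\<^sup>2) has_derivative
      (\<lambda>v. gradient h z \<bullet> v + 2 * lam * (z \<bullet> v))) (at z)"
    if "h differentiable (at z)" for h :: "'a \<Rightarrow> real" and z
  proof -
    have "(h has_derivative (\<lambda>v. gradient h z \<bullet> v)) (at z)"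
      using that by (simp add: gradient_inner frechet_derivative_works)
    then show ?thesis
      unfolding power2_norm_eq_inner
      by (auto intro!: derivative_eq_intros simp: inner_commute algebra_simps)
  qed
  have "gradient f x \<bullet> (y - x) + 2 * lam * (x \<bullet> (y - x)) \<ge> 0"
    by (rule is_arg_min_on_convex_variational[OF K xy(2) x reg[OF diff(1)[OF xy(1)]]])
  moreover have "gradient g y \<bullet> (x - y) + 2 * lam * (y \<bullet> (x - y)) \<ge> 0"
    by (rule is_arg_min_on_convex_variational[OF K xy(1) y reg[OF diff(2)[OF xy(2)]]])
  moreover have "gradient f y \<bullet> (y - x) - gradient f x \<bullet> (y - x) \<ge> - 2 * \<rho> * (norm (y - x))\<^sup>2"
    using second_derivative_lower_bound_imp_monotone[OF K xy diff2 lower]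
    by (simp add: gradient_inner diff xy)
  moreover have "(gradient f y - gradient g y) \<bullet> (y - x) \<le> 2 * D * norm (y - x)"
    using norm_cauchy_schwarz mult_right_mono[OF grad[OF xy(2)] norm_ge_zero] by (rule order_trans)
  moreover have "(norm (y - x))\<^sup>2 = y \<bullet> (y - x) - x \<bullet> (y - x)"
    by (simp add: power2_norm_eq_inner inner_diff_left)
  moreover have "y \<bullet> (x - y) = - (y \<bullet> (y - x))" "gradient g y \<bullet> (x - y) = - (gradient g y \<bullet> (y - x))"
    by (simp_all add: inner_diff_right)
  \<comment> \<open>The two variational inequalities, the monotonicity bound and the Cauchy-Schwarz
    bound, added and divided by 2.\<close>
  ultimately have "lam * (norm (y - x))\<^sup>2 - \<rho> * (norm (y - x))\<^sup>2 \<le> D * norm (y - x)"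
    by (simp add: inner_diff_left right_diff_distrib)
  then have "(lam - \<rho>) * (norm (y - x))\<^sup>2 \<le> D * norm (y - x)"
    by (simp add: left_diff_distrib)
  then have "(lam - \<rho>) * norm (y - x) \<le> D"
    using False by (simp add: power2_eq_square)
  then show ?thesis
    using lam by (simp add: norm_minus_commute field_simps)
qed

section \<open>Smoothness of the data term and of the reconstruction\<close>

text \<open>The denominator is constant in the parameter, so \<open>J0\<close> is a constant times a
  squared residual and inherits two derivatives from \<open>R\<close>. As
  \<open>frechet_derivative\<close> is a choice operator, this is what gives
  \<open>second_derivative\<close> its intended meaning.\<close>

lemma J0_twice_differentiable:
  fixes R :: "'a::real_normed_vector \<Rightarrow> 'f::euclidean_space ^ 'n ^ 'm"
  assumes U: "open U" "x \<in> U" and R: "C2_on U R"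
  shows "J0 eps ybar R Y differentiable (at x)"
    and "(\<lambda>z. frechet_derivative (J0 eps ybar R Y) (at z) u) differentiable (at x)"
proof -
  obtain R' :: "'a \<Rightarrow> 'a \<Rightarrow>\<^sub>L ('f ^ 'n ^ 'm)" and R''
    where R': "\<And>z. z \<in> U \<Longrightarrow> (R has_derivative R' z) (at z)"
      and R'': "\<And>z. z \<in> U \<Longrightarrow> (R' has_derivative blinfun_apply (R'' z)) (at z)"
    using R unfolding C2_on_def by blast
  define c where "c = (norm (Y - ref_matrix ybar))\<^sup>2 + eps"
  define D where "D z u = 2 * ((R z - Y) \<bullet> R' z u) / c" for z u
  \<comment> \<open>Writing the residual as \<open>R z - Y\<close> keeps its norm and avoids a sign
    in the derivative.\<close>
  have J0_eq: "J0 eps ybar R Y = (\<lambda>z. (R z - Y) \<bullet> (R z - Y) / c)"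
    by (simp add: J0_def c_def fun_eq_iff power2_norm_eq_inner[symmetric] norm_minus_commute)
  have der: "(J0 eps ybar R Y has_derivative D z) (at z)" if "z \<in> U" for z
    unfolding J0_eq D_def divide_inverse
    by (auto intro!: derivative_eq_intros R'[OF that] simp: inner_commute algebra_simps)
  then show "J0 eps ybar R Y differentiable (at x)"
    using U by (auto simp: differentiable_def)
  have "((\<lambda>z. D z u) has_derivative
      (\<lambda>v. 2 * (R' x v \<bullet> R' x u + (R x - Y) \<bullet> R'' x v u) / c)) (at x)"
    unfolding D_def divide_inverse
    by (auto intro!: derivative_eq_intros R' R'' U simp: algebra_simps)
  \<comment> \<open>The formula \<open>D z u\<close> is known only for \<open>z\<close> in
    \<open>U\<close>; since \<open>U\<close> is open, agreement there is enough for the derivative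
    at \<open>x\<close>.\<close>
  then have "((\<lambda>z. frechet_derivative (J0 eps ybar R Y) (at z) u) has_derivative
      (\<lambda>v. 2 * (R' x v \<bullet> R' x u + (R x - Y) \<bullet> R'' x v u) / c)) (at x)"
  proof (rule has_derivative_transform_within_open[OF _ U])
    show "D z u = frechet_derivative (J0 eps ybar R Y) (at z) u" if "z \<in> U" for z
      using frechet_derivative_at[OF der[OF that]] by simp
  qed
  then show "(\<lambda>z. frechet_derivative (J0 eps ybar R Y) (at z) u) differentiable (at x)"
    unfolding differentiable_def by blast
qed

text \<open>Carries stability from minimizers to reconstructions. The derivative of \<open>R\<close>
  is itself differentiable, hence continuous and bounded on the compact \<open>K\<close>; on a
  convex set that bound is a Lipschitz constant.\<close>

lemma C2_on_imp_lipschitz_on: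
  fixes R :: "'a::real_normed_vector \<Rightarrow> 'b::real_normed_vector"
  assumes K: "compact K" "convex K" "K \<subseteq> U" and R: "C2_on U R"
  obtains c where "c-lipschitz_on K R"
proof -
  obtain R' :: "'a \<Rightarrow> 'a \<Rightarrow>\<^sub>L 'b" and R''
    where R': "\<And>z. z \<in> U \<Longrightarrow> (R has_derivative R' z) (at z)"
      and R'': "\<And>z. z \<in> U \<Longrightarrow> (R' has_derivative blinfun_apply (R'' z)) (at z)"
    using R unfolding C2_on_def by blast
  have "continuous_on K R'"
    using R'' K(3) by (intro continuous_at_imp_continuous_on) (auto intro: has_derivative_continuous)
  then have "bounded (R' ` K)"
    using K(1) by (intro compact_imp_bounded compact_continuous_image)
  then obtain c where c: "c > 0" "\<And>z. z \<in> K \<Longrightarrow> norm (R' z) \<le> c"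
    unfolding bounded_pos by auto
  have "norm (R x - R y) \<le> c * norm (x - y)" if "x \<in> K" "y \<in> K" for x y
    using K(2) that c(2) R' K(3)
    by (intro differentiable_bound[of K R "\<lambda>z. blinfun_apply (R' z)"])
      (auto simp: norm_blinfun.rep_eq[symmetric] intro: has_derivative_at_withinI)
  then have "c-lipschitz_on K R"
    using c(1) by (intro lipschitz_onI) (auto simp: dist_norm)
  then show thesis by (rule that)
qed

section \<open>Existence, uniqueness and stability for the calibration window\<close>

theorem theorem2:
  fixes Y :: "'f::{real_normed_field,euclidean_space} ^ 't::{finite,linorder} ^ 'm::{finite,linorder}"
    and ybar :: "'f ^ 'm::{finite,linorder}"
    and t :: "'t \<Rightarrow> real"
    and t0 \<tau> eps :: real
    and NQ ns H na nb nk :: nat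
    and Y\<^sub>I :: "'f ^ 'n::{finite,linorder} ^ 'm::{finite,linorder}"
    and \<Phi> :: "'f ^ 'r::{finite,linorder} ^ 'q::{finite,linorder}"
    and C :: "'f ^ 'k::{finite,linorder} ^ 'r::{finite,linorder}"
    and \<phi> :: "'f ^ 'd::{finite,linorder} \<Rightarrow> 'f ^ 'p"
    and \<K> :: "('f ^ 'p ^ 'r::{finite,linorder}) set"
    and R :: "'f ^ 'p ^ 'r::{finite,linorder} \<Rightarrow> 'f ^ 'n::{finite,linorder} ^ 'm::{finite,linorder}"
  assumes times: "\<tau> > 0" "\<And>i. t i = t0 + real (pos i) * \<tau>"
    and window: "1 \<le> NQ" "NQ < CARD('t)" "ns = NQ + 1" "ns + H \<le> CARD('t)"
      "CARD('n) = H + 1"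
    and Y\<^sub>I: "Y\<^sub>I = window_data Y ns"
    and hankel_columns: "CARD('k) + CARD('q) = CARD('m) * CARD('n) + 1"
    and admissible: "CARD('k) \<ge> 2"
    and modes: "hermitian \<Phi> ** \<Phi> = mat 1"
    and C: "C = coeff_matrix \<Phi> ybar Y\<^sub>I"
    and orders: "na \<ge> 1" "nb \<ge> 1" "nk \<ge> 1"
    and lag: "max_lag na nb nk < CARD('k)"
    and features: "CARD('d) = CARD('r) * (na + nb)"
    and eps: "eps > 0"
    and R: "R = reconstruct na nb nk \<phi> \<Phi> ybar C"
    and nonempty: "\<K> \<noteq> {}"
    and closed: "closed \<K>"
    and cont: "continuous_on UNIV \<phi>"
    and finite_sim: "\<And>B k. B \<in> \<K> \<Longrightarrow> k \<in> {1..CARD('k)} \<Longrightarrow>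
      ereal (norm (sim_seq na nb nk \<phi> C B k)) < \<infinity>"
  shows
    "(\<forall>lam>0. \<exists>B. is_arg_min (Jreg eps ybar R lam Y\<^sub>I) (\<lambda>B. B \<in> \<K>) B) \<and>
     (\<forall>V \<rho> L lam.
        compact \<K> \<longrightarrow> convex \<K> \<longrightarrow>
        (\<exists>U. open U \<and> \<K> \<subseteq> U \<and> C2_on U R) \<longrightarrow>
        bounded V \<longrightarrow> Y\<^sub>I \<in> interior V \<longrightarrow> \<rho> \<ge> 0 \<longrightarrow> L \<ge> 0 \<longrightarrow>
        (\<forall>B\<in>\<K>. \<forall>\<Delta>. \<forall>Y\<in>V.
           second_derivative (J0 eps ybar R Y) B \<Delta> \<Delta> \<ge> - 2 * \<rho> * (norm \<Delta>)\<^sup>2) \<longrightarrow>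
        (\<forall>B\<in>\<K>. \<forall>Y1\<in>V. \<forall>Y2\<in>V.
           norm (gradient (J0 eps ybar R Y1) B - gradient (J0 eps ybar R Y2) B)
             \<le> 2 * L * norm (Y1 - Y2)) \<longrightarrow>
        lam > \<rho> \<longrightarrow> lam > 0 \<longrightarrow>
        (let Bstar = (\<lambda>Y. arg_min_on (Jreg eps ybar R lam Y) \<K>) in
          (\<forall>Y\<in>V. \<exists>!B. is_arg_min (Jreg eps ybar R lam Y) (\<lambda>B. B \<in> \<K>) B) \<and>
          (\<forall>Y1\<in>V. \<forall>Y2\<in>V.
             norm (Bstar Y1 - Bstar Y2) \<le> L / (lam - \<rho>) * norm (Y1 - Y2)) \<and>
          (\<forall>Y\<in>V. \<exists>!W. \<exists>B. is_arg_min (Jreg eps ybar R lam Y) (\<lambda>B. B \<in> \<K>) B \<and> W = R B) \<and>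
          (\<exists>c. c-lipschitz_on V (\<lambda>Y. R (Bstar Y)))))"
proof -
  have contR: "continuous_on S R" for S
    unfolding R using cont by (rule continuous_on_reconstruct)
  have denom: "(norm (Z - ref_matrix ybar))\<^sup>2 + eps > 0" for Z :: "'f ^ 'n::{finite,linorder} ^ 'm::{finite,linorder}"
    using eps by (simp add: add_nonneg_pos)
  \<comment> \<open>\<open>J0\<close> is nonnegative, so the penalty alone supplies the quadratic
    lower bound. The data \<open>Z\<close> are arbitrary because stability compares minimizers for
    varying data with \<open>R\<close> fixed.\<close>
  have ex: "\<exists>B. is_arg_min (Jreg eps ybar R lam Z) (\<lambda>B. B \<in> \<K>) B" if "lam > 0" for lam Z
  proof (rule arg_min_on_closed_coercive[OF closed nonempty _ that])
    show "continuous_on \<K> (Jreg eps ybar R lam Z)"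
      unfolding Jreg_def[abs_def] J0_def
      using denom[of Z] by (intro continuous_intros contR) auto
    show "lam * (norm B)\<^sup>2 \<le> Jreg eps ybar R lam Z B" for B
      using denom[of Z] by (simp add: Jreg_def J0_def)
  qed
  have stable: "(\<forall>Z\<in>V. \<exists>!B. is_arg_min (Jreg eps ybar R lam Z) (\<lambda>B. B \<in> \<K>) B) \<and>
      (\<forall>Y1\<in>V. \<forall>Y2\<in>V. norm (arg_min_on (Jreg eps ybar R lam Y1) \<K> -
         arg_min_on (Jreg eps ybar R lam Y2) \<K>) \<le> L / (lam - \<rho>) * norm (Y1 - Y2)) \<and>
      (\<forall>Z\<in>V. \<exists>!W. \<exists>B. is_arg_min (Jreg eps ybar R lam Z) (\<lambda>B. B \<in> \<K>) B \<and> W = R B) \<and>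
      (\<exists>c. c-lipschitz_on V (\<lambda>Z. R (arg_min_on (Jreg eps ybar R lam Z) \<K>)))"
    if K: "compact \<K>" "convex \<K>"
      and U: "open U" "\<K> \<subseteq> U" "C2_on U R"
      and L: "L \<ge> 0"
      and lower: "\<And>B \<Delta> Z. B \<in> \<K> \<Longrightarrow> Z \<in> V \<Longrightarrow>
        second_derivative (J0 eps ybar R Z) B \<Delta> \<Delta> \<ge> - 2 * \<rho> * (norm \<Delta>)\<^sup>2"
      and grad: "\<And>B Y1 Y2. B \<in> \<K> \<Longrightarrow> Y1 \<in> V \<Longrightarrow> Y2 \<in> V \<Longrightarrow>
        norm (gradient (J0 eps ybar R Y1) B - gradient (J0 eps ybar R Y2) B)
          \<le> 2 * L * norm (Y1 - Y2)"
      and lam: "lam > \<rho>" "lam > 0"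
    for V U \<rho> L lam
  proof -
    have est: "norm (B1 - B2) \<le> L / (lam - \<rho>) * norm (Y1 - Y2)"
      if Y12: "Y1 \<in> V" "Y2 \<in> V"
        and B1: "is_arg_min (Jreg eps ybar R lam Y1) (\<lambda>B. B \<in> \<K>) B1"
        and B2: "is_arg_min (Jreg eps ybar R lam Y2) (\<lambda>B. B \<in> \<K>) B2" for Y1 Y2 B1 B2
    proof -
      note diff = J0_twice_differentiable[OF U(1) subsetD[OF U(2)] U(3)]
      \<comment> \<open>Here \<open>D\<close> is \<open>L * norm (Y1 - Y2)\<close>.\<close>
      have "norm (B1 - B2) \<le> L * norm (Y1 - Y2) / (lam - \<rho>)"
        using regularized_arg_min_stable[OF K(2) diff(1) diff(1) diff(2) lower[OF _ Y12(1)] _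
            B1[unfolded Jreg_def[abs_def]] B2[unfolded Jreg_def[abs_def]] lam(1)] grad[OF _ Y12]
        by (simp add: mult.assoc)
      then show ?thesis by simp
    qed
    \<comment> \<open>For equal data the right-hand side of \<open>est\<close> is 0.\<close>
    have uniq: "\<exists>!B. is_arg_min (Jreg eps ybar R lam Z) (\<lambda>B. B \<in> \<K>) B" if "Z \<in> V" for Z
      using ex[OF lam(2)] est[OF that that] by (intro ex_ex1I) auto
    \<comment> \<open>\<open>arg_min_on\<close> chooses some minimizer, so existence suffices here,
      for every \<open>Z\<close>.\<close>
    have star: "is_arg_min (Jreg eps ybar R lam Z) (\<lambda>B. B \<in> \<K>) (arg_min_on (Jreg eps ybar R lam Z) \<K>)"
      for Z
      unfolding arg_min_on_def arg_min_def by (rule someI_ex[OF ex[OF lam(2)]])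
    obtain c where c: "c-lipschitz_on \<K> R"
      using C2_on_imp_lipschitz_on[OF K U(2,3)] .
    have star_lip: "(L / (lam - \<rho>))-lipschitz_on V (\<lambda>Z. arg_min_on (Jreg eps ybar R lam Z) \<K>)"
      using L lam(1) est[OF _ _ star star] by (intro lipschitz_onI) (auto simp: dist_norm)
    \<comment> \<open>Composition multiplies the constants; the minimizers lie in
      \<open>\<K>\<close>, where \<open>R\<close> has constant \<open>c\<close>.\<close>
    have "(c * (L / (lam - \<rho>)))-lipschitz_on V (\<lambda>Z. R (arg_min_on (Jreg eps ybar R lam Z) \<K>))"
    proof (rule lipschitz_on_compose2[OF star_lip lipschitz_on_subset[OF c]])
      show "(\<lambda>Z. arg_min_on (Jreg eps ybar R lam Z) \<K>) ` V \<subseteq> \<K>"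
        using star by (auto simp: is_arg_min_linorder)
    qed
    moreover have "\<exists>!W. \<exists>B. is_arg_min (Jreg eps ybar R lam Z) (\<lambda>B. B \<in> \<K>) B \<and> W = R B"
      if "Z \<in> V" for Z
      using uniq[OF that] by blast
    ultimately show ?thesis
      using uniq est[OF _ _ star star] by blast
  qed
  show ?thesis
    unfolding Let_def
  proof (rule conjI; intro allI impI)
    show "\<exists>B. is_arg_min (Jreg eps ybar R lam Y\<^sub>I) (\<lambda>B. B \<in> \<K>) B" if "lam > 0" for lam
      using that by (rule ex)
  qed (elim exE conjE, rule stable, blast+)
qed

end
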